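(* Let $\circ\in\{\land,\lor\}$, let $r \in \mathbb N$ and let $S$ be the leftist circuit over $\{\circ\}$ on inputs $x_0, \dotsc, x_{r-1}$. Let $N \subseteq \{x_0,\dots,x_{r-1}\}$ be triangular with $n := |N| \geq 1$. Let $d \in \mathbb N_{>0}$ be the unique integer with $2^{d-1} \leq n < 2^d$ and let $k := 2^{d-1}$. Let $K \subseteq N$ be an output of the procedure $\mathrm{TriSubset}(S,N)$ and let $B := B(K, S)$. Then: (1) if $n - k \geq 2$, then $|B| + \lfloor 2 \log_2 (n-k-1)\rfloor \leq \lfloor 2 \log_2 (n-1)\rfloor$; (2) if $n \geq 16$, then $|B| + \rho(n-k) \leq \rho(n)$.
   Context: Circuits: a circuit over $\{\circ\}$ on inputs $x_0,\dots,x_{r-1}$ is a finite directed acyclic graph whose sources are the input vertices and whose other vertices are gates, each with exactly two predecessors. For a vertex $v$, $\mathrm{In}_v(S)$ is the set of input vertices from which there is a directed path to $v$ ($\mathrm{In}_v(S)=\{v\}$ for an input). The depth of a vertex is the maximum number of edges on a directed path from an input to it. Leftist circuit: the circuit $S$ on $x_0,\dots,x_{r-1}$ constructed as follows. Set $i=0$, $M=r$; while $M \ge 2$: let $k'$ be maximal with $2^{k'}\le M$, add a perfect binary tree of $\circ$-gates of depth $k'$ whose leaves, read from left to right, are $x_i,\dots,x_{i+2^{k'}-1}$, then set $i\leftarrow i+2^{k'}$, $M\leftarrow M-2^{k'}$. Each vertex $v$ has $\mathrm{In}_v(S)=\{x_j: j\in I_v\}$ for an index interval $I_v$; $v$ is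 left of $w$ if $I_v\cap I_w=\emptyset$ and $\max I_v<\min I_w$. Boundary vertices: for $K\subseteq\{x_0,\dots,x_{r-1}\}$, $B(K,S)=\{v : \mathrm{In}_v(S)\subseteq K \text{ and } \mathrm{In}_w(S)\not\subseteq K \text{ for every successor } w \text{ of } v\}$. The boundary tree sequence $T_0,\dots,T_{|B|-1}$ of $K$ consists of the subcircuits formed by each boundary vertex $b$ together with all vertices having a directed path to $b$ (perfect binary trees), ordered from left to right; $\mathrm{depth}(T_j)$ is the depth of its root and $\mathrm{In}(T_j)$ its set of inputs. $K$ is triangular if there is $J\in\{0,\dots,|B|-1\}$ such that the inputs of $T_0,\dots,T_J$ form a set of inputs with consecutive indices, the inputs of $T_{J+1},\dots,T_{|B|-1}$ form a set of inputs with consecutive indices, $\mathrm{depth}(T_j)<\mathrm{depth}(T_{j+1})$ for $0\le j<J-1$, and $\mathrm{depth}(T_j)>\mathrm{depth}(T_{j+1})$ for $J+1\le j<|B|-1$; the empty set is also triangular. Procedure $\mathrm{TriSubset}(S,N)$ (for triangular $N$ with $2^{d-1}\le |N|<2^d$): let $T_0,\dots,T_{p-1}$ be the boundary tree sequence of $N$. If some $T_j$ has depth $d-1$, return $\mathrm{In}(T_j)$. Otherwise let $D$ be the largest $d'$ such that there exist $j_0<j_1$ with $\mathrm{depth}(T_{j_0})=\mathrm{depth}(T_{j_1})=d'$, choose such $j_0<j_1$ with depth $D$, and return $\bigcup_{j=j_0}^{j_1}\mathrm{In}(T_j)$. The function $\rho\colon\mathbb N\to\mathbb R_{\ge 0}$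 is $\rho(n)=n$ for $n\in\{0,1,2\}$ and $\rho(n)=\lfloor 2\log_2(n-1)\rfloor$ for $n\ge 3$.
   Formalization: In the definition of triangular, depth(T_j) < depth(T_{j+1}) is required for 0 ≤ j < J instead of 0 ≤ j < J−1; with the printed range the claim fails, e.g. r = 64, N = {x_1,…,x_16} ∪ {x_32,…,x_46}. *)

theory Defs
  imports Complex_Main
begin

datatype gate_op = And_gate | Or_gate

text \<open>
  The list \<^term>\<open>inputs\<close> enumerates $x_0, \dots, x_{r-1}$. The domain of \<^term>\<open>gates\<close> is the set of
  gate vertices. A pair in \<^term>\<open>wires\<close> leads from a predecessor to its successor.
\<close>

record 'v circuit =
  inputs :: "'v list"
  gates :: "'v \<rightharpoonup> gate_op"
  wires :: "('v \<times> 'v) set"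

definition vertices :: "'v circuit \<Rightarrow> 'v set" where
  "vertices S = set (inputs S) \<union> dom (gates S)"

definition circuit_over :: "gate_op set \<Rightarrow> 'v circuit \<Rightarrow> bool" where
  "circuit_over \<Omega> S \<longleftrightarrow>
     distinct (inputs S) \<and> finite (dom (gates S)) \<and> set (inputs S) \<inter> dom (gates S) = {} \<and>
     ran (gates S) \<subseteq> \<Omega> \<and>
     wires S \<subseteq> vertices S \<times> dom (gates S) \<and> acyclic (wires S) \<and>
     (\<forall>g \<in> dom (gates S). card {u. (u, g) \<in> wires S} = 2)"

definition In :: "'v circuit \<Rightarrow> 'v \<Rightarrow> 'v set" where
  "In S v = {x \<in> set (inputs S). (x, v) \<in> (wires S)\<^sup>*}"

definition depth :: "'v circuit \<Rightarrow> 'v \<Rightarrow> nat" where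
  "depth S v = Max {l. \<exists>x \<in> set (inputs S). (x, v) \<in> wires S ^^ l}"


text \<open>
  Vertices of the leftist circuit are named by the formula they compute, which is unambiguous
  because distinct gates of that circuit have distinct formulas.
\<close>

datatype vertex = Input nat | Gate vertex vertex

fun perfect_tree :: "nat \<Rightarrow> nat \<Rightarrow> vertex" where
  "perfect_tree i 0 = Input i"
| "perfect_tree i (Suc k) = Gate (perfect_tree i k) (perfect_tree (i + 2 ^ k) k)"

fun add_tree :: "gate_op \<Rightarrow> vertex \<Rightarrow> vertex circuit \<Rightarrow> vertex circuit" where
  "add_tree c (Input i) S = S"
| "add_tree c (Gate a b) S =
     (let S' = add_tree c b (add_tree c a S)
      in S'\<lparr>gates := (gates S')(Gate a b \<mapsto> c),
            wires := {(a, Gate a b), (b, Gate a b)} \<union> wires S'\<rparr>)"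

function leftist_loop :: "gate_op \<Rightarrow> nat \<Rightarrow> nat \<Rightarrow> vertex circuit \<Rightarrow> vertex circuit" where
  "leftist_loop c i M S =
     (if M < 2 then S
      else let k' = (GREATEST k'. 2 ^ k' \<le> M)
           in leftist_loop c (i + 2 ^ k') (M - 2 ^ k') (add_tree c (perfect_tree i k') S))"
  by auto
termination
  by (relation "Wellfounded.measure (\<lambda>(c, i, M, S). M)") auto

declare leftist_loop.simps [simp del]

definition leftist_circuit :: "gate_op \<Rightarrow> nat \<Rightarrow> vertex circuit" where
  "leftist_circuit c r =
     leftist_loop c 0 r \<lparr>inputs = map Input [0..<r], gates = Map.empty, wires = {}\<rparr>"


definition index_set :: "'v circuit \<Rightarrow> 'v \<Rightarrow> nat set" where
  "index_set S v = {j. j < length (inputs S) \<and> inputs S ! j \<in> In S v}"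

definition left_of :: "'v circuit \<Rightarrow> 'v \<Rightarrow> 'v \<Rightarrow> bool" where
  "left_of S v w \<longleftrightarrow>
     index_set S v \<inter> index_set S w = {} \<and> Max (index_set S v) < Min (index_set S w)"

definition boundary :: "'v set \<Rightarrow> 'v circuit \<Rightarrow> 'v set" where
  "boundary K S =
     {v \<in> vertices S. In S v \<subseteq> K \<and> (\<forall>w. (v, w) \<in> wires S \<longrightarrow> \<not> In S w \<subseteq> K)}"

text \<open>
  A boundary tree $T_j$ is represented by its root \<^term>\<open>ts ! j\<close>, a boundary vertex. So its depth is
  \<^term>\<open>depth S (ts ! j)\<close> and its set of inputs is \<^term>\<open>In S (ts ! j)\<close>.
\<close>

definition boundary_tree_seq :: "'v circuit \<Rightarrow> 'v set \<Rightarrow> 'v list \<Rightarrow> bool" where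
  "boundary_tree_seq S K ts \<longleftrightarrow>
     distinct ts \<and> set ts = boundary K S \<and> sorted_wrt (left_of S) ts"

definition consecutive :: "'v circuit \<Rightarrow> 'v set \<Rightarrow> bool" where
  "consecutive S A \<longleftrightarrow> (\<exists>a b. b \<le> length (inputs S) \<and> A = (\<lambda>j. inputs S ! j) ` {a..<b})"

text \<open>
  The depths increase strictly along the whole first block $T_0, \dots, T_J$. Read literally, the
  range $0 \le j < J - 1$ leaves $T_J$ unconstrained, which is an off-by-one
  error: on 64 inputs, $N = \{x_1, \dots, x_{16}\} \cup \{x_{32}, \dots, x_{46}\}$
  has boundary depths $0, 1, 2, 3, 0$ and $3, 2, 1, 0$. The only output of \<open>TriSubset\<close> would have 17
  elements and 3 boundary vertices, and with $n = 31$, $k = 16$ the bound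
  $3 + \lfloor 2 \log_2 14 \rfloor \le \lfloor 2 \log_2 30 \rfloor$ fails.
\<close>

definition triangular :: "'v circuit \<Rightarrow> 'v set \<Rightarrow> bool" where
  "triangular S K \<longleftrightarrow> K = {} \<or>
     (\<exists>ts J. boundary_tree_seq S K ts \<and> J < length ts \<and>
        consecutive S (\<Union>j \<in> {0..J}. In S (ts ! j)) \<and>
        consecutive S (\<Union>j \<in> {J + 1..<length ts}. In S (ts ! j)) \<and>
        (\<forall>j. j < J \<longrightarrow> depth S (ts ! j) < depth S (ts ! (j + 1))) \<and>
        (\<forall>j. J + 1 \<le> j \<and> j + 1 < length ts \<longrightarrow> depth S (ts ! j) > depth S (ts ! (j + 1))))"

definition largest_repeated_depth :: "'v circuit \<Rightarrow> 'v list \<Rightarrow> nat" where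
  "largest_repeated_depth S ts =
     Max {d'. \<exists>j\<^sub>0 j\<^sub>1. j\<^sub>0 < j\<^sub>1 \<and> j\<^sub>1 < length ts \<and>
                depth S (ts ! j\<^sub>0) = d' \<and> depth S (ts ! j\<^sub>1) = d'}"

text \<open>
  The procedure makes choices, so it is a relation: \<open>TriSubset S N K\<close> says that \<open>K\<close> is a possible
  output on \<open>N\<close>.
\<close>

definition TriSubset :: "'v circuit \<Rightarrow> 'v set \<Rightarrow> 'v set \<Rightarrow> bool" where
  "TriSubset S N K \<longleftrightarrow>
     (\<exists>d ts. 0 < d \<and> 2 ^ (d - 1) \<le> card N \<and> card N < 2 ^ d \<and> boundary_tree_seq S N ts \<and>
        (if \<exists>j < length ts. depth S (ts ! j) = d - 1
         then \<exists>j < length ts. depth S (ts ! j) = d - 1 \<and> K = In S (ts ! j)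
         else \<exists>j\<^sub>0 j\<^sub>1. j\<^sub>0 < j\<^sub>1 \<and> j\<^sub>1 < length ts \<and>
                depth S (ts ! j\<^sub>0) = largest_repeated_depth S ts \<and>
                depth S (ts ! j\<^sub>1) = largest_repeated_depth S ts \<and>
                K = (\<Union>j \<in> {j\<^sub>0..j\<^sub>1}. In S (ts ! j))))"

definition \<rho> :: "nat \<Rightarrow> real" where
  "\<rho> n = (if n \<le> 2 then real n else of_int \<lfloor>2 * log 2 (real n - 1)\<rfloor>)"


fun leftmost :: "vertex \<Rightarrow> nat" where
  "leftmost (Input i) = i"
| "leftmost (Gate a b) = leftmost a"

lemma leftmost_perfect_tree: "leftmost (perfect_tree i k) = i"
  by (induction i k rule: perfect_tree.induct) auto

definition formula_circuit :: "gate_op \<Rightarrow> vertex circuit \<Rightarrow> bool" where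
  "formula_circuit c S \<longleftrightarrow>
     finite (dom (gates S)) \<and> ran (gates S) \<subseteq> {c} \<and>
     (\<forall>g \<in> dom (gates S). \<exists>a b. g = Gate a b \<and> a \<noteq> b \<and> a \<in> vertices S \<and> b \<in> vertices S) \<and>
     wires S = {(u, g). g \<in> dom (gates S) \<and> (\<exists>a b. g = Gate a b \<and> (u = a \<or> u = b))}"

lemma formula_circuit_add_gate:
  assumes "formula_circuit c S" "a \<in> vertices S" "b \<in> vertices S" "a \<noteq> b"
  shows "formula_circuit c (S\<lparr>gates := (gates S)(Gate a b \<mapsto> c),
            wires := {(a, Gate a b), (b, Gate a b)} \<union> wires S\<rparr>)"
proof -
  have ran: "ran ((gates S)(Gate a b \<mapsto> c)) \<subseteq> {c}"
    using assms(1) by (auto simp: formula_circuit_def ran_def split: if_splits)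
  have wires: "{(a, Gate a b), (b, Gate a b)} \<union> wires S =
      {(u, g). g \<in> insert (Gate a b) (dom (gates S)) \<and> (\<exists>a b. g = Gate a b \<and> (u = a \<or> u = b))}"
  proof -
    have "wires S = {(u, g). g \<in> dom (gates S) \<and> (\<exists>a b. g = Gate a b \<and> (u = a \<or> u = b))}"
      using assms(1) unfolding formula_circuit_def by (elim conjE)
    then show ?thesis by (simp only:) auto
  qed
  have fin: "finite (dom (gates S))"
    and G: "\<And>g. g \<in> dom (gates S) \<Longrightarrow>
      \<exists>a b. g = Gate a b \<and> a \<noteq> b \<and> a \<in> vertices S \<and> b \<in> vertices S"
    using assms(1) unfolding formula_circuit_def by (elim conjE, simp)+
  let ?S = "S\<lparr>gates := (gates S)(Gate a b \<mapsto> c),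
            wires := {(a, Gate a b), (b, Gate a b)} \<union> wires S\<rparr>"
  have dom: "dom (gates ?S) = insert (Gate a b) (dom (gates S))"
    by simp
  have sub: "vertices S \<subseteq> vertices ?S"
    by (auto simp: vertices_def)
  have gates: "\<exists>a b. g = Gate a b \<and> a \<noteq> b \<and> a \<in> vertices ?S \<and> b \<in> vertices ?S"
    if "g \<in> dom (gates ?S)" for g
    using that assms(2-4) G[of g] sub unfolding dom by blast
  have ran': "ran (gates ?S) \<subseteq> {c}"
    using ran by simp
  have wires': "wires ?S =
      {(u, g). g \<in> dom (gates ?S) \<and> (\<exists>a b. g = Gate a b \<and> (u = a \<or> u = b))}"
    unfolding dom using wires by simp
  have fin': "finite (dom (gates ?S))"
    using fin by simp
  show ?thesis
    unfolding formula_circuit_def using fin' ran' gates wires' by (intro conjI ballI)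
qed

lemma add_tree_perfect_tree:
  assumes "formula_circuit c S" "\<forall>j \<in> {i..<i + 2 ^ k}. Input j \<in> vertices S"
  defines "S' \<equiv> add_tree c (perfect_tree i k) S"
  shows "formula_circuit c S' \<and> inputs S' = inputs S \<and> vertices S \<subseteq> vertices S' \<and>
         perfect_tree i k \<in> vertices S'"
  using assms(1,2) unfolding S'_def
proof (induction k arbitrary: i S)
  case 0
  then show ?case by auto
next
  case (Suc k)
  let ?a = "perfect_tree i k" and ?b = "perfect_tree (i + 2 ^ k) k"
  let ?S1 = "add_tree c ?a S"
  let ?S2 = "add_tree c ?b ?S1"
  have 1: "formula_circuit c ?S1 \<and> inputs ?S1 = inputs S \<and> vertices S \<subseteq> vertices ?S1 \<and>
      ?a \<in> vertices ?S1"
    using Suc.prems by (intro Suc.IH) auto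
  have 2: "formula_circuit c ?S2 \<and> inputs ?S2 = inputs ?S1 \<and> vertices ?S1 \<subseteq> vertices ?S2 \<and>
      ?b \<in> vertices ?S2"
    using Suc.prems 1 by (intro Suc.IH) auto
  have "leftmost ?a \<noteq> leftmost ?b"
    by (simp add: leftmost_perfect_tree)
  then have "?a \<noteq> ?b"
    by metis
  then have 3: "formula_circuit c (?S2\<lparr>gates := (gates ?S2)(Gate ?a ?b \<mapsto> c),
            wires := {(?a, Gate ?a ?b), (?b, Gate ?a ?b)} \<union> wires ?S2\<rparr>)"
    using 1 2 by (intro formula_circuit_add_gate) auto
  from 1 2 have "vertices S \<subseteq> vertices ?S2" "inputs ?S2 = inputs S"
    by auto
  with 3 show ?case
    by (auto simp: Let_def vertices_def)
qed

lemma leftist_loop_formula_circuit: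
  assumes "formula_circuit c S" "\<forall>j \<in> {i..<i + M}. Input j \<in> vertices S"
  shows "formula_circuit c (leftist_loop c i M S) \<and> inputs (leftist_loop c i M S) = inputs S"
  using assms
proof (induction c i M S rule: leftist_loop.induct)
  case (1 c i M S)
  show ?case
  proof (cases "M < 2")
    case True
    then show ?thesis using 1 by (simp add: leftist_loop.simps)
  next
    case False
    define k' where "k' = (GREATEST k'. 2 ^ k' \<le> M)"
    have le: "2 ^ k' \<le> M"
      unfolding k'_def
    proof (rule GreatestI_nat[where k = 0 and b = M])
      show "y \<le> M" if "2 ^ y \<le> M" for y :: nat
        using that less_exp[of y] by linarith
    qed (use False in auto)
    let ?S' = "add_tree c (perfect_tree i k') S"
    have *: "formula_circuit c ?S' \<and> inputs ?S' = inputs S \<and> vertices S \<subseteq> vertices ?S'"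
      using add_tree_perfect_tree[of c S i k'] 1(2,3) le by fastforce
    have "formula_circuit c (leftist_loop c (i + 2 ^ k') (M - 2 ^ k') ?S') \<and>
        inputs (leftist_loop c (i + 2 ^ k') (M - 2 ^ k') ?S') = inputs ?S'"
      using * 1(3) le by (intro 1(1)[OF False k'_def]) auto
    then show ?thesis
      using * False
      by (subst (1 2) leftist_loop.simps) (simp add: Let_def flip: k'_def)
  qed
qed

lemma circuit_over_leftist_circuit: "circuit_over {c} (leftist_circuit c r)"
proof -
  let ?S = "leftist_circuit c r"
  let ?E = "\<lparr>inputs = map Input [0..<r], gates = Map.empty, wires = {}\<rparr> :: vertex circuit"
  have "formula_circuit c ?E" "\<forall>j \<in> {0..<0 + r}. Input j \<in> vertices ?E"
    by (auto simp: formula_circuit_def vertices_def)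
  from leftist_loop_formula_circuit[OF this]
  have "formula_circuit c ?S \<and> inputs ?S = inputs ?E"
    unfolding leftist_circuit_def .
  then have F: "formula_circuit c ?S" and I: "inputs ?S = map Input [0..<r]"
    by simp_all
  note F' = F[unfolded formula_circuit_def]
  note fin = F'[THEN conjunct1] and ran = F'[THEN conjunct2, THEN conjunct1]
    and G = F'[THEN conjunct2, THEN conjunct2, THEN conjunct1, THEN bspec]
    and W = F'[THEN conjunct2, THEN conjunct2, THEN conjunct2]
  have "wires ?S \<subseteq> Wellfounded.measure size"
    unfolding W by auto
  then have "acyclic (wires ?S)"
    by (meson acyclic_subset wf_acyclic wf_measure)
  moreover have "card {u. (u, g) \<in> wires ?S} = 2" if g: "g \<in> dom (gates ?S)" for g
  proof -
    obtain a b where ab: "g = Gate a b" "a \<noteq> b"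
      using G[OF g] by blast
    then have "{u. (u, g) \<in> wires ?S} = {a, b}"
      using g unfolding W by auto
    with ab show ?thesis by simp
  qed
  moreover have "wires ?S \<subseteq> vertices ?S \<times> dom (gates ?S)"
    using G unfolding W by blast
  moreover have "set (inputs ?S) \<inter> dom (gates ?S) = {}"
    unfolding I using G by fastforce
  moreover have "distinct (inputs ?S)"
    unfolding I by (simp add: distinct_map inj_on_def)
  ultimately show ?thesis
    using fin ran unfolding circuit_over_def by blast
qed

end

theory Submission
  imports Defs
begin

text \<open>
  If no boundary tree of \<^term>\<open>N\<close> has depth $d - 1$, let $D$ be the largest repeated depth.
  Comparing $n \ge 2^{d-1}$ with geometric sums shows that every depth in $\{D+1, \dots, d-2\}$ occurs
  exactly once, and that it occurs between the two trees of depth $D$. Hence $|K| = k$,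
  $|B| = d - D$ and $n - k \le 2^{D+1} - 2$. With $m = n - k$ and $s = |B| - 2$, this gives
  $n - 1 \ge (2^s + 1)(m - 1)$, and $(2^s + 1)^2 \ge 2^{s+2}$ yields
  $2^{|B|} (m-1)^2 \le (n-1)^2$, which is the claim after taking logarithms.
\<close>

section \<open>Boundaries in arbitrary circuits\<close>

lemma In_mono_rtrancl: "(v, w) \<in> (wires S)\<^sup>* \<Longrightarrow> In S v \<subseteq> In S w"
  by (auto simp: In_def)

text \<open>Climb from \<open>v\<close> along wires for as long as the inputs stay inside
  \<open>N\<close>. Finiteness and acyclicity force the climb to stop, and a vertex where no
  successor stays inside \<open>N\<close> is by definition a boundary vertex.\<close>

lemma ex_boundary_above:
  assumes S: "circuit_over \<Omega> S" and "v \<in> vertices S" "In S v \<subseteq> N"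
  shows "\<exists>w \<in> boundary N S. (v, w) \<in> (wires S)\<^sup>*"
proof -
  have sub: "wires S \<subseteq> vertices S \<times> dom (gates S)"
    and fin: "finite (dom (gates S))" and ac: "acyclic (wires S)"
    using S by (auto simp: circuit_over_def)
  have "finite (wires S)"
    by (rule finite_subset[OF sub]) (use fin in \<open>simp add: vertices_def\<close>)
  then have "wf ((wires S)\<inverse>)"
    using ac by (rule finite_acyclic_wf_converse)
  then show ?thesis
    using assms(2,3)
  proof (induction v rule: wf_induct_rule)
    case (less v)
    show ?case
    proof (cases "v \<in> boundary N S")
      case False
      then obtain w where w: "(v, w) \<in> wires S" "In S w \<subseteq> N"
        using less.prems by (auto simp: boundary_def)
      then have "w \<in> vertices S"
        using sub by (auto simp: vertices_def)
      then show ?thesis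
        using less.IH[of w] w by (meson converse_iff converse_rtrancl_into_rtrancl)
    qed auto
  qed
qed

text \<open>No wire enters an input, so an input \<open>x\<close> in \<open>N\<close> has only
  itself below it; hence some boundary vertex lies above \<open>x\<close>.\<close>

lemma Union_In_boundary:
  assumes "circuit_over \<Omega> S" "N \<subseteq> set (inputs S)"
  shows "(\<Union>v \<in> boundary N S. In S v) = N"
proof
  show "(\<Union>v \<in> boundary N S. In S v) \<subseteq> N"
    by (auto simp: boundary_def)
  show "N \<subseteq> (\<Union>v \<in> boundary N S. In S v)"
  proof
    fix x assume x: "x \<in> N"
    have no_wire: "(y, x) \<notin> wires S" for y
      using assms x by (auto simp: circuit_over_def)
    have "y = x" if "(y, x) \<in> (wires S)\<^sup>*" for y
      using that no_wire by (auto elim: rtranclE)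
    then have "In S x \<subseteq> N"
      using x by (auto simp: In_def)
    moreover have "x \<in> vertices S"
      using assms x by (auto simp: vertices_def)
    ultimately obtain w where "w \<in> boundary N S" "(x, w) \<in> (wires S)\<^sup>*"
      using ex_boundary_above[OF assms(1)] by blast
    moreover have "x \<in> In S w"
      using assms(2) x calculation by (auto simp: In_def)
    ultimately show "x \<in> (\<Union>v \<in> boundary N S. In S v)"
      by blast
  qed
qed

text \<open>Identifies \<open>boundary K S\<close> for the outputs \<open>K\<close> of
  \<open>TriSubset\<close>, which are unions of boundary trees of \<open>N\<close>. A vertex
  \<open>v\<close> with inputs in \<open>?K\<close> lies below some boundary vertex \<open>w\<close>
  of \<open>N\<close>. It shares an input with some \<open>u\<close> in \<open>A\<close>, so
  disjointness gives \<open>w = u\<close>. If \<open>v\<close> were strictly below \<open>w\<close>,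
  its successor on the path to \<open>w\<close> would still have its inputs inside
  \<open>?K\<close>.\<close>

lemma boundary_Union_In:
  assumes S: "circuit_over \<Omega> S"
    and ne: "\<forall>v \<in> vertices S. In S v \<noteq> {}"
    and disj: "\<forall>v \<in> boundary N S. \<forall>w \<in> boundary N S. v \<noteq> w \<longrightarrow> In S v \<inter> In S w = {}"
    and A: "A \<subseteq> boundary N S"
  shows "boundary (\<Union>v \<in> A. In S v) S = A"
proof -
  let ?K = "\<Union>v \<in> A. In S v"
  have KN: "?K \<subseteq> N"
    using A by (auto simp: boundary_def)
  show ?thesis
  proof
    \<comment> \<open>A successor whose inputs leave \<open>N\<close> also leaves the smaller set
      \<open>?K\<close>.\<close>
    show "A \<subseteq> boundary ?K S"
      using A KN by (fastforce simp: boundary_def)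
    show "boundary ?K S \<subseteq> A"
    proof
      fix v assume v: "v \<in> boundary ?K S"
      then have v': "v \<in> vertices S" "In S v \<subseteq> ?K"
        by (auto simp: boundary_def)
      then obtain w where w: "w \<in> boundary N S" "(v, w) \<in> (wires S)\<^sup>*"
        using ex_boundary_above[OF S v'(1), of N] KN by blast
      obtain x where x: "x \<in> In S v"
        using ne v' by blast
      then obtain u where u: "u \<in> A" "x \<in> In S u"
        using v' by blast
      have "x \<in> In S w"
        using x In_mono_rtrancl[OF w(2)] by blast
      then have "w = u"
        using disj w(1) u A by blast
      have "v = w"
      proof (rule ccontr)
        assume "v \<noteq> w"
        then obtain p where p: "(v, p) \<in> wires S" "(p, w) \<in> (wires S)\<^sup>*"
          using w(2) by (metis converse_rtranclE)
        then have "In S p \<subseteq> ?K"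
          using In_mono_rtrancl[OF p(2)] u \<open>w = u\<close> by blast
        then show False
          using v p by (auto simp: boundary_def)
      qed
      then show "v \<in> A"
        using u \<open>w = u\<close> by simp
    qed
  qed
qed

section \<open>Left-to-right order: boundary tree sequences are unique and disjoint\<close>

lemma finite_index_set: "finite (index_set S v)"
  by (simp add: index_set_def)

lemma index_set_nonempty:
  assumes "In S v \<noteq> {}"
  shows "index_set S v \<noteq> {}"
proof -
  obtain x where "x \<in> In S v"
    using assms by blast
  moreover from this obtain j where "j < length (inputs S)" "inputs S ! j = x"
    by (auto simp: In_def in_set_conv_nth)
  ultimately show ?thesis
    by (auto simp: index_set_def)
qed

lemma left_of_imp_In_disjoint:
  assumes "left_of S v w"
  shows "In S v \<inter> In S w = {}"
proof (rule ccontr)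
  assume "In S v \<inter> In S w \<noteq> {}"
  then obtain x where x: "x \<in> In S v" "x \<in> In S w"
    by blast
  then obtain j where "j < length (inputs S)" "inputs S ! j = x"
    by (auto simp: In_def in_set_conv_nth)
  with x assms show False
    by (auto simp: left_of_def index_set_def)
qed

lemma left_of_imp_Min_less:
  assumes "left_of S v w" "In S v \<noteq> {}"
  shows "Min (index_set S v) < Min (index_set S w)"
proof -
  have "Min (index_set S v) \<le> Max (index_set S v)"
    using finite_index_set index_set_nonempty[OF assms(2)] by (meson Max_ge Min_in)
  with assms(1) show ?thesis
    by (simp add: left_of_def)
qed

text \<open>The least input index increases strictly along such a sequence, so sorting by it
  recovers the list from its set. This is needed because \<open>triangular\<close> and
  \<open>TriSubset\<close> each quantify over a sequence of their own.\<close>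

lemma boundary_tree_seq_unique:
  assumes ne: "\<forall>v \<in> vertices S. In S v \<noteq> {}"
    and ts: "boundary_tree_seq S N ts" and us: "boundary_tree_seq S N us"
  shows "ts = us"
proof -
  define f where "f v = Min (index_set S v)" for v
  have sorted: "sorted_wrt (<) (map f xs)" if "boundary_tree_seq S N xs" for xs
  proof -
    have "sorted_wrt (left_of S) xs" "\<forall>v \<in> set xs. In S v \<noteq> {}"
      using that ne by (auto simp: boundary_tree_seq_def boundary_def)
    then show ?thesis
      unfolding sorted_wrt_map sorted_wrt_iff_nth_less f_def
      by (simp add: left_of_imp_Min_less)
  qed
  have eq: "set ts = set us"
    using ts us by (simp add: boundary_tree_seq_def)
  have "map f ts = map f us"
    using sorted[OF ts] sorted[OF us] eq by (intro strict_sorted_equal) auto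
  moreover have "inj_on f (set ts \<union> set us)"
    using sorted[OF ts] eq by (simp add: strict_sorted_iff distinct_map)
  ultimately show ?thesis
    by (simp add: inj_on_map_eq_map)
qed

lemma boundary_tree_seq_disjoint:
  assumes "boundary_tree_seq S N ts" "i < length ts" "j < length ts" "i \<noteq> j"
  shows "In S (ts ! i) \<inter> In S (ts ! j) = {}"
proof -
  have "left_of S (ts ! i) (ts ! j) \<or> left_of S (ts ! j) (ts ! i)"
    using assms by (cases i j rule: linorder_cases)
      (auto simp: boundary_tree_seq_def sorted_wrt_iff_nth_less)
  then show ?thesis
    using left_of_imp_In_disjoint by (metis Int_commute)
qed

section \<open>The leftist circuit\<close>

text \<open>Second invariant of the construction: \<open>formula_circuit\<close> determines the
  wires from the gate formulas but leaves the shape of these formulas open.\<close>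

definition perfect_gates :: "vertex circuit \<Rightarrow> bool" where
  "perfect_gates S \<longleftrightarrow> (\<forall>g \<in> dom (gates S). \<exists>i k. g = perfect_tree i k)"

lemma perfect_gates_add_tree:
  "perfect_gates S \<Longrightarrow> perfect_gates (add_tree c (perfect_tree i k) S)"
proof (induction k arbitrary: i S)
  case (Suc k)
  let ?S = "add_tree c (perfect_tree (i + 2 ^ k) k) (add_tree c (perfect_tree i k) S)"
  have "perfect_gates ?S"
    using Suc by blast
  moreover have "\<exists>i' k'. Gate (perfect_tree i k) (perfect_tree (i + 2 ^ k) k) = perfect_tree i' k'"
    by (metis perfect_tree.simps(2))
  ultimately show ?case
    by (auto simp: Let_def perfect_gates_def)
qed simp

lemma perfect_gates_leftist_loop:
  "perfect_gates S \<Longrightarrow> perfect_gates (leftist_loop c i M S)"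
proof (induction c i M S rule: leftist_loop.induct)
  case (1 c i M S)
  then show ?case
    by (subst leftist_loop.simps) (auto simp: Let_def perfect_gates_add_tree)
qed

lemma leftist_circuit_structure:
  fixes c :: gate_op and r :: nat
  defines "S \<equiv> leftist_circuit c r"
  shows formula_circuit_leftist_circuit: "formula_circuit c S"
    and inputs_leftist_circuit: "inputs S = map Input [0..<r]"
    and perfect_gates_leftist_circuit: "perfect_gates S"
proof -
  let ?E = "\<lparr>inputs = map Input [0..<r], gates = Map.empty, wires = {}\<rparr> :: vertex circuit"
  have "formula_circuit c ?E" "\<forall>j \<in> {0..<0 + r}. Input j \<in> vertices ?E" "perfect_gates ?E"
    by (auto simp: formula_circuit_def vertices_def perfect_gates_def)
  then show "formula_circuit c S" "inputs S = map Input [0..<r]" "perfect_gates S"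
    unfolding S_def leftist_circuit_def
    using leftist_loop_formula_circuit perfect_gates_leftist_loop by force+
qed

lemma leftist_circuit_vertex_perfect_tree:
  assumes "v \<in> vertices (leftist_circuit c r)"
  obtains i k where "v = perfect_tree i k"
proof (cases "v \<in> dom (gates (leftist_circuit c r))")
  case True
  then show ?thesis
    using perfect_gates_leftist_circuit[of c r] that by (auto simp: perfect_gates_def)
next
  case False
  then obtain i where "v = perfect_tree i 0"
    using assms by (auto simp: vertices_def inputs_leftist_circuit)
  then show ?thesis
    by (rule that)
qed

text \<open>Fixing start and length of the path together yields both \<open>In\<close> and
  \<open>depth\<close>: all paths from inputs to the root have the same length. In the induction,
  the last wire of a path comes from one of the two half trees.\<close>

lemma leftist_circuit_path_to_perfect_tree:
  fixes c :: gate_op and r :: nat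
  defines "S \<equiv> leftist_circuit c r"
  assumes "perfect_tree i k \<in> vertices S"
  shows "x \<in> set (inputs S) \<and> (x, perfect_tree i k) \<in> wires S ^^ l \<longleftrightarrow>
           x \<in> Input ` {i..<i + 2 ^ k} \<and> l = k"
proof -
  have F: "formula_circuit c S" and I: "inputs S = map Input [0..<r]"
    by (simp_all add: S_def formula_circuit_leftist_circuit inputs_leftist_circuit)
  have W: "wires S = {(u, g). g \<in> dom (gates S) \<and> (\<exists>a b. g = Gate a b \<and> (u = a \<or> u = b))}"
    using F unfolding formula_circuit_def by (elim conjE)
  have G: "\<exists>a b. g = Gate a b \<and> a \<in> vertices S \<and> b \<in> vertices S" if "g \<in> dom (gates S)" for g
    using F that unfolding formula_circuit_def by (elim conjE) (drule bspec, assumption, blast)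
  show ?thesis
    using assms(2)
  proof (induction k arbitrary: i l)
    case 0
    \<comment> \<open>Every gate has the form \<open>Gate a b\<close>, so \<open>Input i\<close> can
      only be an input vertex.\<close>
    then have *: "Input i \<in> set (inputs S)"
      using G[of "Input i"] by (auto simp: vertices_def)
    have "(u, Input i) \<notin> wires S" for u
      unfolding W by simp
    with * show ?case
      by (cases l) auto
  next
    case (Suc k)
    let ?a = "perfect_tree i k" and ?b = "perfect_tree (i + 2 ^ k) k"
    have g: "Gate ?a ?b \<in> dom (gates S)"
      using Suc.prems by (auto simp: vertices_def I)
    then have ab: "?a \<in> vertices S" "?b \<in> vertices S"
      using G[OF g] by simp_all
    have pred: "(u, Gate ?a ?b) \<in> wires S \<longleftrightarrow> u = ?a \<or> u = ?b" for u
      unfolding W using g by blast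
    have "{i..<i + 2 ^ Suc k} = {i..<i + 2 ^ k} \<union> {i + 2 ^ k..<i + 2 ^ k + 2 ^ k}"
      by auto
    then have split: "Input ` {i..<i + 2 ^ Suc k} =
        Input ` {i..<i + 2 ^ k} \<union> Input ` {i + 2 ^ k..<i + 2 ^ k + 2 ^ k}"
      by (simp only: image_Un)
    show ?case
    proof (cases l)
      case 0
      then show ?thesis
        by (auto simp: I)
    next
      case (Suc l')
      have "(x, Gate ?a ?b) \<in> wires S ^^ l \<longleftrightarrow> (x, ?a) \<in> wires S ^^ l' \<or> (x, ?b) \<in> wires S ^^ l'"
        unfolding Suc relpow.simps relcomp_unfold mem_Collect_eq case_prod_conv
          perfect_tree.simps pred by blast
      then show ?thesis
        unfolding split perfect_tree.simps
        using Suc.IH[OF ab(1), of l'] Suc.IH[OF ab(2), of l'] Suc by blast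
    qed
  qed
qed

lemma leftist_circuit_In:
  assumes "perfect_tree i k \<in> vertices (leftist_circuit c r)"
  shows "In (leftist_circuit c r) (perfect_tree i k) = Input ` {i..<i + 2 ^ k}"
  using leftist_circuit_path_to_perfect_tree[OF assms]
  unfolding In_def rtrancl_power by blast

lemma leftist_circuit_depth:
  assumes "perfect_tree i k \<in> vertices (leftist_circuit c r)"
  shows "depth (leftist_circuit c r) (perfect_tree i k) = k"
proof -
  let ?S = "leftist_circuit c r"
  have "{l. \<exists>x \<in> set (inputs ?S). (x, perfect_tree i k) \<in> wires ?S ^^ l} =
      {l. \<exists>x. x \<in> Input ` {i..<i + 2 ^ k} \<and> l = k}"
    using leftist_circuit_path_to_perfect_tree[OF assms] by blast
  also have "\<dots> = {k}"
    by auto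
  finally show ?thesis
    by (simp add: depth_def)
qed

lemma leftist_circuit_card_In:
  assumes "v \<in> vertices (leftist_circuit c r)"
  shows "card (In (leftist_circuit c r) v) = 2 ^ depth (leftist_circuit c r) v"
proof -
  obtain i k where "v = perfect_tree i k"
    using leftist_circuit_vertex_perfect_tree[OF assms] .
  then show ?thesis
    using assms by (simp add: leftist_circuit_In leftist_circuit_depth card_image inj_on_def)
qed

section \<open>Sums of powers of two with unimodal exponents\<close>

lemma sum_power2_atLeastLessThan:
  "a \<le> b \<Longrightarrow> (\<Sum>e \<in> {a..<b}. (2::nat) ^ e) + 2 ^ a = 2 ^ b"
  by (induction rule: dec_induct) auto

text \<open>Distinct exponents below \<open>D\<close> contribute at most the full geometric sum
  \<open>2 ^ D - 1\<close>; the form with \<open>+ 1\<close> avoids subtraction on naturals.\<close>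

lemma sum_power2_inj_le:
  fixes f :: "'a \<Rightarrow> nat"
  assumes "inj_on f A" "f ` A \<subseteq> {..<D}"
  shows "(\<Sum>j \<in> A. (2::nat) ^ f j) + 1 \<le> 2 ^ D"
proof -
  have "(\<Sum>j \<in> A. (2::nat) ^ f j) = (\<Sum>e \<in> f ` A. 2 ^ e)"
    using assms(1) by (simp add: sum.reindex)
  also have "\<dots> \<le> (\<Sum>e \<in> {0..<D}. 2 ^ e)"
    using assms(2) by (intro sum_mono2) auto
  finally show ?thesis
    using sum_power2_atLeastLessThan[of 0 D] by simp
qed

text \<open>Here \<open>f j\<close> stands for the depth of the \<open>j\<close>-th boundary tree,
  \<open>q\<close> for \<open>d - 1\<close> and the sum for \<open>n\<close>. The conclusions give
  the number of trees from \<open>j\<^sub>0\<close> to \<open>j\<^sub>1\<close> and an upper bound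
  on \<open>n\<close>. The sum is cut at these two positions, and each piece is compared with a
  geometric sum.\<close>

lemma unimodal_power2_sum:
  fixes f :: "nat \<Rightarrow> nat"
  assumes inc: "\<And>i j. i < j \<Longrightarrow> j \<le> J \<Longrightarrow> f i < f j"
    and dec: "\<And>i j. J < i \<Longrightarrow> i < j \<Longrightarrow> j < p \<Longrightarrow> f j < f i"
    and low: "(2::nat) ^ q \<le> (\<Sum>j<p. 2 ^ f j)"
    and small: "\<And>j. j < p \<Longrightarrow> f j < q"
    and j: "j\<^sub>0 < j\<^sub>1" "j\<^sub>1 < p" "f j\<^sub>0 = D" "f j\<^sub>1 = D"
    and rep: "\<And>i j. i < j \<Longrightarrow> j < p \<Longrightarrow> f i = f j \<Longrightarrow> f i \<le> D"
  shows "j\<^sub>1 + 1 - j\<^sub>0 + D = q + 1" and "D < q"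
    and "(\<Sum>j<p. 2 ^ f j) + 2 \<le> 2 ^ q + (2::nat) ^ (D + 1)"
proof -
  \<comment> \<open>Both monotone blocks are injective, so two equal values must lie in different
    blocks.\<close>
  have J: "j\<^sub>0 \<le> J" "J < j\<^sub>1"
    using inc[of j\<^sub>0 j\<^sub>1] dec[of j\<^sub>0 j\<^sub>1] j by linarith+
  show "D < q"
    using small[of j\<^sub>1] j by simp
  let ?L = "{..<j\<^sub>0}" and ?M = "{j\<^sub>0<..<j\<^sub>1}" and ?R = "{j\<^sub>1<..<p}"
  let ?s = "\<lambda>A. \<Sum>j \<in> A. (2::nat) ^ f j"
  have "{..<p} = ?L \<union> ?M \<union> ?R \<union> {j\<^sub>0, j\<^sub>1}"
    using j by auto
  also have "?s \<dots> = ?s ?L + ?s ?M + ?s ?R + ?s {j\<^sub>0, j\<^sub>1}"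
  proof -
    have "?L \<inter> ?M = {}" "(?L \<union> ?M) \<inter> ?R = {}" "(?L \<union> ?M \<union> ?R) \<inter> {j\<^sub>0, j\<^sub>1} = {}"
      using j by auto
    then show ?thesis
      by (simp only: sum.union_disjoint finite_Un finite_lessThan finite_greaterThanLessThan
          finite.emptyI finite.insertI simp_thms)
  qed
  also have "?s {j\<^sub>0, j\<^sub>1} = 2 ^ (D + 1)"
    using j by simp
  finally have total: "?s {..<p} = ?s ?L + ?s ?M + ?s ?R + 2 ^ (D + 1)" .
  have inj: "inj_on f A" if "A \<subseteq> {..J} \<or> A \<subseteq> {J<..<p}" for A
  proof (rule linorder_inj_onI')
    fix x y assume "x \<in> A" "y \<in> A" "x < y"
    moreover from this have "y \<le> J \<or> J < x \<and> y < p"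
      using that by (auto simp: subset_iff)
    ultimately show "f x \<noteq> f y"
      using inc[of x y] dec[of x y] by auto
  qed
  have L: "?s ?L + 1 \<le> 2 ^ D"
    using J j inc[of _ j\<^sub>0] by (intro sum_power2_inj_le inj) auto
  have R: "?s ?R + 1 \<le> 2 ^ D"
    using J j dec[of j\<^sub>1] by (intro sum_power2_inj_le inj) auto
  \<comment> \<open>Moving inwards from \<open>j\<^sub>0\<close> or from \<open>j\<^sub>1\<close>,
    the values rise above \<open>D\<close>. A repetition between them would then contradict the
    maximality of \<open>D\<close>.\<close>
  have above: "D < f i" if "i \<in> ?M" for i
    using that inc[of j\<^sub>0 i] dec[of i j\<^sub>1] j by (cases "i \<le> J") auto
  have M: "inj_on f ?M"
  proof (rule linorder_inj_onI')
    fix x y assume "x \<in> ?M" "y \<in> ?M" "x < y"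
    then show "f x \<noteq> f y"
      using above[of x] rep[of x y] j by auto
  qed
  have Msub: "f ` ?M \<subseteq> {D + 1..<q}"
    using above small j by (auto simp: Suc_le_eq)
  have Msum: "?s ?M = (\<Sum>e \<in> f ` ?M. 2 ^ e)"
    using M by (simp add: sum.reindex)
  have range: "(\<Sum>e \<in> {D + 1..<q}. (2::nat) ^ e) + 2 ^ (D + 1) = 2 ^ q"
    using \<open>D < q\<close> by (intro sum_power2_atLeastLessThan) simp
  have Meq: "f ` ?M = {D + 1..<q}"
  proof (rule ccontr)
    \<comment> \<open>A missing exponent \<open>e > D\<close> costs at least
      \<open>2 ^ (D + 1)\<close>. The two outer pieces together contribute at most
      \<open>2 ^ (D + 1) - 2\<close>, so the total falls below \<open>2 ^ q\<close>, against
      \<open>low\<close>.\<close>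
    assume "f ` ?M \<noteq> {D + 1..<q}"
    then obtain e where e: "e \<in> {D + 1..<q}" "e \<notin> f ` ?M"
      using Msub by blast
    have "(\<Sum>e \<in> f ` ?M. (2::nat) ^ e) + 2 ^ e = (\<Sum>e \<in> insert e (f ` ?M). 2 ^ e)"
      using e by simp
    also have "\<dots> \<le> (\<Sum>e \<in> {D + 1..<q}. 2 ^ e)"
      using e Msub by (intro sum_mono2) auto
    finally have "?s ?M + 2 ^ e + 2 ^ (D + 1) \<le> 2 ^ q"
      using Msum range by linarith
    moreover have "(2::nat) ^ (D + 1) \<le> 2 ^ e"
      using e by (intro power_increasing) auto
    ultimately show False
      using total L R low by simp
  qed
  have "card ?M = card (f ` ?M)"
    using M by (simp add: card_image)
  then have "j\<^sub>1 - Suc j\<^sub>0 = q - (D + 1)"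
    unfolding Meq by simp
  then show "j\<^sub>1 + 1 - j\<^sub>0 + D = q + 1"
    using j \<open>D < q\<close> by linarith
  have "?s ?M + 2 ^ (D + 1) = 2 ^ q"
    using Msum Meq range by simp
  then show "?s {..<p} + 2 \<le> 2 ^ q + 2 ^ (D + 1)"
    using total L R by simp
qed

section \<open>The logarithmic bounds\<close>

text \<open>The integer \<open>b\<close> can be moved inside the floor, where it becomes the factor
  \<open>2 ^ b\<close> under the logarithm; this reduces both claims to inequalities between
  squares.\<close>

lemma add_floor_log_le:
  fixes x y :: real
  assumes "0 < x" "0 < y" "2 ^ b * x\<^sup>2 \<le> y\<^sup>2"
  shows "int b + \<lfloor>2 * log 2 x\<rfloor> \<le> \<lfloor>2 * log 2 y\<rfloor>"
proof -
  have "real b + 2 * log 2 x = log 2 (2 ^ b * x\<^sup>2)"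
    using assms by (simp add: log_mult log_nat_power)
  also have "\<dots> \<le> log 2 (y\<^sup>2)"
    using assms by simp
  also have "\<dots> = 2 * log 2 y"
    using assms by (simp add: log_nat_power)
  finally show ?thesis
    by linarith
qed

text \<open>Applied with \<open>m = n - k\<close>, \<open>e = D + 1\<close> and \<open>s + 2\<close>
  boundary vertices of \<open>K\<close>.\<close>

lemma square_bound_of_AM_GM:
  fixes m k s e :: nat
  assumes "1 \<le> m" "m + 2 \<le> 2 ^ e" "k = 2 ^ (s + e)"
  shows "2 ^ (s + 2) * (real m - 1)\<^sup>2 \<le> (real k + real m - 1)\<^sup>2"
proof -
  have "real (m + 2) \<le> 2 ^ e"
    using assms(2) by (metis of_nat_le_iff of_nat_numeral of_nat_power)
  then have "2 ^ s * (real m - 1) \<le> 2 ^ s * 2 ^ e"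
    by (intro mult_left_mono) auto
  then have le: "(2 ^ s + 1) * (real m - 1) \<le> real k + real m - 1"
    by (simp add: assms(3) power_add algebra_simps)
  \<comment> \<open>With \<open>x = 2 ^ s\<close>, this is
    \<open>(x + 1)^2 - 4 * x = (x - 1)^2\<close>.\<close>
  have "0 \<le> ((2::real) ^ s - 1)\<^sup>2"
    by simp
  then have "(2::real) ^ (s + 2) \<le> (2 ^ s + 1)\<^sup>2"
    by (simp add: power2_eq_square algebra_simps)
  then have "2 ^ (s + 2) * (real m - 1)\<^sup>2 \<le> ((2 ^ s + 1) * (real m - 1))\<^sup>2"
    unfolding power_mult_distrib by (intro mult_right_mono) auto
  also have "\<dots> \<le> (real k + real m - 1)\<^sup>2"
    using le assms(1) by (intro power_mono) auto
  finally show ?thesis .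
qed

text \<open>For \<open>m > 2\<close> the values of \<open>\<rho>\<close> are floors of logarithms
  and the square bound applies. For smaller \<open>m\<close> they are not, and
  \<open>b \<le> d\<close> gives enough room instead.\<close>

lemma rho_bound_of_square_bound:
  fixes b d k m n :: nat
  assumes "n = k + m" "k = 2 ^ (d - 1)" "b \<le> d" "5 \<le> d"
    and sq: "2 \<le> m \<Longrightarrow> 2 ^ b * (real m - 1)\<^sup>2 \<le> (real n - 1)\<^sup>2"
  shows "real b + \<rho> m \<le> \<rho> n"
proof -
  have k16: "16 \<le> k"
    using power_increasing[of 4 "d - 1" "2::nat"] assms by simp
  then have rho_n: "\<rho> n = of_int \<lfloor>2 * log 2 (real n - 1)\<rfloor>"
    using assms(1) by (simp add: \<rho>_def)
  show ?thesis
  proof (cases "m \<le> 2")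
    case True
    \<comment> \<open>Since \<open>\<rho> m = m\<close> here, \<open>m\<close> is added to the
      exponent \<open>b\<close>, and \<open>x = 1\<close> makes the remaining logarithm
      vanish.\<close>
    have "int (b + m) + \<lfloor>2 * log 2 1\<rfloor> \<le> \<lfloor>2 * log 2 (real n - 1)\<rfloor>"
    proof (rule add_floor_log_le)
      show "0 < real n - 1"
        using assms(1) k16 by simp
      \<comment> \<open>For \<open>m = 0\<close>, \<open>n - 1 = k - 1\<close> is only bounded below
        by \<open>2 ^ (d - 2)\<close>, and \<open>b \<le> d \<le> 2 * (d - 2)\<close>. Otherwise
        \<open>n - 1\<close> is at least \<open>k\<close>, and
        \<open>b + m \<le> d + 2 \<le> 2 * (d - 1)\<close>.\<close>
      show "(2::real) ^ (b + m) * 1\<^sup>2 \<le> (real n - 1)\<^sup>2"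
      proof (cases "m = 0")
        case True
        have "k = 2 * 2 ^ (d - 2)"
          using assms by (simp flip: power_Suc add: Suc_diff_le numeral_2_eq_2)
        then have "(2::real) ^ (d - 2) \<le> real n - 1"
          using assms(1) True one_le_power[of "2::real" "d - 2"] by simp
        then have "((2::real) ^ (d - 2))\<^sup>2 \<le> (real n - 1)\<^sup>2"
          by (intro power_mono) auto
        moreover have "(2::real) ^ (b + m) \<le> 2 ^ ((d - 2) * 2)"
          using True assms by (intro power_increasing) auto
        ultimately show ?thesis
          by (simp add: power_mult)
      next
        case False
        then have "(2::real) ^ (d - 1) \<le> real n - 1"
          using assms by simp
        then have "((2::real) ^ (d - 1))\<^sup>2 \<le> (real n - 1)\<^sup>2"
          by (intro power_mono) auto
        moreover have "(2::real) ^ (b + m) \<le> 2 ^ ((d - 1) * 2)"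
          using \<open>m \<le> 2\<close> assms by (intro power_increasing) auto
        ultimately show ?thesis
          by (simp add: power_mult)
      qed
    qed simp
    then show ?thesis
      using True unfolding rho_n by (simp add: \<rho>_def)
  next
    case False
    then have "int b + \<lfloor>2 * log 2 (real m - 1)\<rfloor> \<le> \<lfloor>2 * log 2 (real n - 1)\<rfloor>"
      using assms(1) sq by (intro add_floor_log_le) auto
    then show ?thesis
      using False unfolding rho_n by (simp add: \<rho>_def)
  qed
qed

section \<open>The outputs of TriSubset\<close>

text \<open>The alternatives mirror the two branches of the procedure. In the second one,
  \<open>s\<close> counts the trees strictly between the two chosen trees of depth \<open>D\<close>,
  and \<open>e\<close> is \<open>D + 1\<close>.\<close>

lemma TriSubset_boundary_bound:
  assumes S: "S = leftist_circuit c r"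
    and N: "N \<subseteq> set (inputs S)" "triangular S N"
    and n: "n = card N" "1 \<le> n"
    and d: "0 < d" "2 ^ (d - 1) \<le> n" "n < 2 ^ d"
    and K: "TriSubset S N K"
  obtains "card (boundary K S) = 1"
  | s e where "card (boundary K S) = s + 2" "d - 1 = s + e" "1 \<le> e" "n + 2 \<le> 2 ^ (d - 1) + 2 ^ e"
proof -
  have circ: "circuit_over {c} S"
    by (simp add: S circuit_over_leftist_circuit)
  have card_In: "card (In S v) = 2 ^ depth S v" if "v \<in> vertices S" for v
    using that unfolding S by (rule leftist_circuit_card_In)
  have ne: "\<forall>v \<in> vertices S. In S v \<noteq> {}"
    using card_In by fastforce
  obtain d' ts where d': "0 < d'" "2 ^ (d' - 1) \<le> card N" "card N < 2 ^ d'"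
    and ts: "boundary_tree_seq S N ts"
    and out: "if \<exists>j < length ts. depth S (ts ! j) = d' - 1
         then \<exists>j < length ts. depth S (ts ! j) = d' - 1 \<and> K = In S (ts ! j)
         else \<exists>j\<^sub>0 j\<^sub>1. j\<^sub>0 < j\<^sub>1 \<and> j\<^sub>1 < length ts \<and>
                depth S (ts ! j\<^sub>0) = largest_repeated_depth S ts \<and>
                depth S (ts ! j\<^sub>1) = largest_repeated_depth S ts \<and>
                K = (\<Union>j \<in> {j\<^sub>0..j\<^sub>1}. In S (ts ! j))"
    using K unfolding TriSubset_def by blast
  \<comment> \<open>\<open>TriSubset\<close> brings its own exponent \<open>d'\<close>; the dyadic
    interval containing \<open>n\<close> determines it.\<close>
  have "(2::nat) ^ (d - 1) < 2 ^ d'" "(2::nat) ^ (d' - 1) < 2 ^ d"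
    using d d' n by linarith+
  then have "d - 1 < d'" "d' - 1 < d"
    by simp_all
  then have [simp]: "d' = d"
    using d d' by linarith
  have dist: "distinct ts" and set_ts: "set ts = boundary N S"
    using ts by (simp_all add: boundary_tree_seq_def)
  have disj: "In S v \<inter> In S w = {}" if "v \<in> boundary N S" "w \<in> boundary N S" "v \<noteq> w" for v w
    using that boundary_tree_seq_disjoint[OF ts] unfolding set_ts[symmetric]
    by (metis in_set_conv_nth)
  have bd: "boundary (\<Union>v \<in> A. In S v) S = A" if "A \<subseteq> boundary N S" for A
    using boundary_Union_In[OF circ ne _ that] disj by blast
  have fin_In: "finite (In S v)" for v
    by (simp add: In_def)
  let ?f = "\<lambda>j. depth S (ts ! j)"
  have "N = (\<Union>j<length ts. In S (ts ! j))"
    using Union_In_boundary[OF circ N(1)] unfolding set_ts[symmetric] set_conv_nth by auto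
  then have "n = card (\<Union>j<length ts. In S (ts ! j))"
    using n by simp
  also have "\<dots> = (\<Sum>j<length ts. card (In S (ts ! j)))"
    using boundary_tree_seq_disjoint[OF ts] fin_In by (intro card_UN_disjoint) auto
  also have "\<dots> = (\<Sum>j<length ts. 2 ^ ?f j)"
    using set_ts by (intro sum.cong card_In) (force simp: boundary_def)+
  finally have n_sum: "n = (\<Sum>j<length ts. 2 ^ ?f j)" .
  show thesis
  proof (cases "\<exists>j < length ts. ?f j = d' - 1")
    case True
    then obtain j where "j < length ts" "K = In S (ts ! j)"
      using out by auto
    moreover from this have "{ts ! j} \<subseteq> boundary N S"
      by (simp flip: set_ts)
    ultimately have "boundary K S = {ts ! j}"
      using bd[of "{ts ! j}"] by simp
    then show thesis
      using that(1) by simp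
  next
    case False
    define D where "D = largest_repeated_depth S ts"
    obtain j\<^sub>0 j\<^sub>1 where j: "j\<^sub>0 < j\<^sub>1" "j\<^sub>1 < length ts" "?f j\<^sub>0 = D" "?f j\<^sub>1 = D"
      and K_eq: "K = (\<Union>j \<in> {j\<^sub>0..j\<^sub>1}. In S (ts ! j))"
      using out unfolding if_not_P[OF False] D_def by blast
    have "N \<noteq> {}"
      using n by auto
    then obtain us J where us: "boundary_tree_seq S N us" and "J < length us"
      and "\<forall>j. j < J \<longrightarrow> depth S (us ! j) < depth S (us ! (j + 1))"
      and "\<forall>j. J + 1 \<le> j \<and> j + 1 < length us \<longrightarrow> depth S (us ! j) > depth S (us ! (j + 1))"
      using N(2) unfolding triangular_def by auto
    moreover have "us = ts"
      using boundary_tree_seq_unique[OF ne us ts] .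
    ultimately have J: "J < length ts" "\<And>j. j < J \<Longrightarrow> ?f j < ?f (Suc j)"
      "\<And>j. J < j \<Longrightarrow> Suc j < length ts \<Longrightarrow> ?f (Suc j) < ?f j"
      by auto
    have inc: "?f i < ?f j" if "i < j" "j \<le> J" for i j
      using that
    proof (induction j)
      case (Suc j)
      then show ?case
        using J(2)[of j] by (cases "i = j") (auto intro: less_trans)
    qed simp
    have dec: "?f j < ?f i" if "J < i" "i < j" "j < length ts" for i j
      using that(2,1,3)
    proof (induction j)
      case (Suc j)
      then show ?case
        using J(3)[of j] by (cases "i = j") (auto intro: less_trans)
    qed simp
    \<comment> \<open>A tree has at most \<open>n < 2 ^ d\<close> inputs, so its depth is at most
      \<open>d - 1\<close>, and this branch excludes equality.\<close>
    have small: "?f j < d - 1" if "j < length ts" for j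
    proof -
      have "2 ^ ?f j \<le> n"
        unfolding n_sum using that by (intro member_le_sum) auto
      then have "(2::nat) ^ ?f j < 2 ^ d"
        using d by linarith
      then have "?f j < d"
        by simp
      moreover have "?f j \<noteq> d - 1"
        using False that by simp
      ultimately show ?thesis
        by linarith
    qed
    let ?R = "{d'. \<exists>i j. i < j \<and> j < length ts \<and> ?f i = d' \<and> ?f j = d'}"
    have "finite ?R"
      by (rule finite_subset[of _ "?f ` {..<length ts}"]) auto
    then have rep: "?f i \<le> D" if "i < j" "j < length ts" "?f i = ?f j" for i j
      unfolding D_def largest_repeated_depth_def using that by (intro Max_ge) auto
    note sum = unimodal_power2_sum[where f = ?f and J = J and p = "length ts" and q = "d - 1"
        and D = D and j\<^sub>0 = j\<^sub>0 and j\<^sub>1 = j\<^sub>1, folded n_sum]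
    have bounds: "j\<^sub>1 + 1 - j\<^sub>0 + D = d - 1 + 1" "D < d - 1" "n + 2 \<le> 2 ^ (d - 1) + 2 ^ (D + 1)"
      by (rule sum; fact inc dec d(2) small j rep)+
    have "K = (\<Union>v \<in> (!) ts ` {j\<^sub>0..j\<^sub>1}. In S v)"
      using K_eq by simp
    moreover have "(!) ts ` {j\<^sub>0..j\<^sub>1} \<subseteq> boundary N S"
      using j unfolding set_ts[symmetric] by auto
    ultimately have "boundary K S = (!) ts ` {j\<^sub>0..j\<^sub>1}"
      using bd by blast
    moreover have "inj_on ((!) ts) {j\<^sub>0..j\<^sub>1}"
      using dist j by (intro inj_on_nth) auto
    ultimately have "card (boundary K S) = j\<^sub>1 + 1 - j\<^sub>0"
      by (simp add: card_image)
    \<comment> \<open>\<open>D < d - 1\<close> makes the truncated difference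
      \<open>d - 2 - D\<close> exact.\<close>
    then show thesis
      using bounds by (intro that(2)[of "d - 2 - D" "D + 1"]) linarith+
  qed
qed

theorem mainTheorem3:
  fixes c :: gate_op and r n d k :: nat
    and S :: "vertex circuit" and N K B :: "vertex set"
  assumes "S = leftist_circuit c r"
    and "N \<subseteq> set (inputs S)"
    and "triangular S N"
    and "n = card N" and "n \<ge> 1"
    and "d > 0" and "2 ^ (d - 1) \<le> n" and "n < 2 ^ d"
    and "k = 2 ^ (d - 1)"
    and "K \<subseteq> N" and "TriSubset S N K"
    and "B = boundary K S"
  shows "(n - k \<ge> 2 \<longrightarrow>
            int (card B) + \<lfloor>2 * log 2 (real n - real k - 1)\<rfloor> \<le> \<lfloor>2 * log 2 (real n - 1)\<rfloor>) \<and>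
         (n \<ge> 16 \<longrightarrow> real (card B) + \<rho> (n - k) \<le> \<rho> n)"
proof -
  define m where "m = n - k"
  have n: "n = k + m"
    using assms(7,9) by (simp add: m_def)
  have "m < k"
    using assms(6,8,9) n by (cases d) auto
  \<comment> \<open>The square inequality yields (1), and also (2) for large \<open>m\<close>; the
    bound by \<open>d\<close> serves (2) when \<open>m\<close> is at most 2.\<close>
  have *: "card B \<le> d \<and> (2 \<le> m \<longrightarrow> 2 ^ card B * (real m - 1)\<^sup>2 \<le> (real n - 1)\<^sup>2)"
  proof (rule TriSubset_boundary_bound[OF assms(1-8,11)])
    assume "card (boundary K S) = 1"
    moreover have "2 * (real m - 1)\<^sup>2 \<le> (real n - 1)\<^sup>2" if "2 \<le> m"
    proof -
      \<comment> \<open>As \<open>m < k\<close>, \<open>n - 1 = k + m - 1\<close> is at least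
        \<open>2 * m\<close>, which leaves a factor 4 where 2 is required.\<close>
      have "2 * (real m - 1)\<^sup>2 \<le> (2 * (real m - 1))\<^sup>2"
        unfolding power_mult_distrib by simp
      also have "\<dots> \<le> (real n - 1)\<^sup>2"
        using \<open>m < k\<close> that n by (intro power_mono) auto
      finally show ?thesis .
    qed
    ultimately show ?thesis
      using assms(6,12) by simp
  next
    fix s e
    assume se: "card (boundary K S) = s + 2" "d - 1 = s + e" "1 \<le> e" "n + 2 \<le> 2 ^ (d - 1) + 2 ^ e"
    then have "2 ^ (s + 2) * (real m - 1)\<^sup>2 \<le> (real k + real m - 1)\<^sup>2" if "2 \<le> m"
      using that n assms(9) by (intro square_bound_of_AM_GM[of _ e]) auto
    \<comment> \<open>From \<open>1 \<le> e\<close> also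
      \<open>s + 2 \<le> s + e + 1 = d\<close>.\<close>
    then show ?thesis
      using se assms(12) n by simp
  qed
  have "int (card B) + \<lfloor>2 * log 2 (real m - 1)\<rfloor> \<le> \<lfloor>2 * log 2 (real n - 1)\<rfloor>" if "2 \<le> m"
    using * that n by (intro add_floor_log_le) auto
  moreover have "real (card B) + \<rho> m \<le> \<rho> n" if "16 \<le> n"
  proof (rule rho_bound_of_square_bound[OF n assms(9)])
    have "(2::nat) ^ 4 < 2 ^ d"
      using that assms(8) by simp
    then have "4 < d"
      using power_less_imp_less_exp[of "2::nat" 4 d] by simp
    then show "5 \<le> d"
      by simp
  qed (use * in auto)
  ultimately show ?thesis
    using n by simp
qed

end
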